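(* Let $\mathcal{A}$ be any randomized algorithm with query access to a metric $\mathsf{d}$ on $n$ points that, with constant probability, outputs an $o(n)$-approximation to the sparsest navigable graph on $\mathsf{d}$, under either the maximum out-degree or the total-number-of-edges objective. Then $\mathcal{A}$ must make $\Omega(n^2)$ queries to $\mathsf{d}(\cdot,\cdot)$.
   Context: A directed graph $G=(P,E)$ on a finite metric space $(P,\mathsf{d})$ is navigable ($1$-navigable) if for every $s,t\in P$ with $\mathsf{d}(s,t)>0$ there is $u$ with $(s,u)\in E$ and $\mathsf{d}(u,t)<\mathsf{d}(s,t)$. A navigable graph is a $c$-approximation to the sparsest navigable graph under the maximum out-degree (resp. total-edges) objective if its maximum out-degree (resp. number of edges) is at most $c$ times that of every navigable graph on the metric. A query returns $\mathsf{d}(i,j)$ for a chosen pair $i,j$. *)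

theory Defs
  imports "HOL-Probability.Probability" "HOL-Library.Landau_Symbols"
begin

definition navigable :: "'a set \<Rightarrow> ('a \<Rightarrow> 'a \<Rightarrow> real) \<Rightarrow> ('a \<times> 'a) set \<Rightarrow> bool" where
  "navigable P d E \<longleftrightarrow> E \<subseteq> P \<times> P \<and>
     (\<forall>s\<in>P. \<forall>t\<in>P. d s t > 0 \<longrightarrow> (\<exists>u. (s, u) \<in> E \<and> d u t < d s t))"

definition max_out_degree :: "'a set \<Rightarrow> ('a \<times> 'a) set \<Rightarrow> nat" where
  "max_out_degree P E = Max ((\<lambda>s. card {u. (s, u) \<in> E}) ` P)"

definition num_edges :: "'a set \<Rightarrow> ('a \<times> 'a) set \<Rightarrow> nat" where
  "num_edges P E = card E"

definition approx_sparsest_navigable ::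
    "('a set \<Rightarrow> ('a \<times> 'a) set \<Rightarrow> nat) \<Rightarrow> real \<Rightarrow> 'a set \<Rightarrow> ('a \<Rightarrow> 'a \<Rightarrow> real) \<Rightarrow> ('a \<times> 'a) set \<Rightarrow> bool" where
  "approx_sparsest_navigable obj c P d E \<longleftrightarrow> navigable P d E \<and>
     (\<forall>E'. navigable P d E' \<longrightarrow> real (obj P E) \<le> c * real (obj P E'))"

text \<open>Deterministic adaptive query algorithms are decision trees: a node \<open>Query i j k\<close> asks for
  the distance between the points \<open>i\<close> and \<open>j\<close> and continues with the subtree \<open>k x\<close>, where
  \<open>x\<close> is the answer. The depth need not be bounded, since a node has one child per real number.
  Computation between queries is free.\<close>

datatype query_alg =
    Output "(nat \<times> nat) set"
  | Query nat nat "real \<Rightarrow> query_alg"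

primrec on_points :: "nat \<Rightarrow> query_alg \<Rightarrow> bool" where
  "on_points n (Output E) \<longleftrightarrow> E \<subseteq> {..<n} \<times> {..<n}"
| "on_points n (Query i j k) \<longleftrightarrow> i < n \<and> j < n \<and> (\<forall>x. on_points n (k x))"

primrec run :: "(nat \<Rightarrow> nat \<Rightarrow> real) \<Rightarrow> query_alg \<Rightarrow> (nat \<times> nat) set" where
  "run d (Output E) = E"
| "run d (Query i j k) = run d (k (d i j))"

primrec num_queries :: "(nat \<Rightarrow> nat \<Rightarrow> real) \<Rightarrow> query_alg \<Rightarrow> nat" where
  "num_queries d (Output E) = 0"
| "num_queries d (Query i j k) = Suc (num_queries d (k (d i j)))"

text \<open>A randomized algorithm draws a random seed \<open>\<omega>\<close> from an arbitrary probability space and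
  then runs the deterministic algorithm \<open>A \<omega>\<close>. On every input metric, the output graph and the
  number of queries have to be random variables.\<close>

definition randomized_query_alg :: "nat \<Rightarrow> 'r measure \<Rightarrow> ('r \<Rightarrow> query_alg) \<Rightarrow> bool" where
  "randomized_query_alg n M A \<longleftrightarrow> prob_space M \<and>
     (\<forall>\<omega>\<in>space M. on_points n (A \<omega>)) \<and>
     (\<forall>d. Metric_space {..<n} d \<longrightarrow>
        (\<lambda>\<omega>. run d (A \<omega>)) \<in> measurable M (count_space (Pow ({..<n} \<times> {..<n}))) \<and>
        (\<lambda>\<omega>. num_queries d (A \<omega>)) \<in> measurable M (count_space UNIV))"

end

theory Submission
  imports Defs
begin

text \<open>
  If all distances between distinct points lie in \<open>[1, 2]\<close>, the triangle inequality is automatic.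
  So the distances \<open>1 + \<bar>i - j\<bar> / n\<close> form a metric, and it remains one when the distance of a
  single pair \<open>{a, b}\<close> is lowered to \<open>1\<close>. The latter metric has a navigable graph of out-degree at
  most 3 (the path together with the edges between \<open>a\<close> and \<open>b\<close>), but every navigable graph contains
  the edge \<open>(a, b)\<close>, because no point other than \<open>b\<close> is closer to \<open>b\<close> than \<open>a\<close>. A run on the
  unmodified metric behaves like the run on the modified one until it queries \<open>{a, b}\<close>. Hence the
  pairs on which a fixed seed succeeds are queried on the unmodified metric or are among the
  \<open>o(n) * 3 * n\<close> edges of the output. Taking expectations and summing over all pairs yields
  \<open>p * n * (n - 1) / 2 \<le> E[queries] + o(n\<^sup>2)\<close>.
\<close>

section \<open>Metrics with nonzero distances in [1, 2]\<close>

definition line_dist :: "nat \<Rightarrow> nat \<Rightarrow> nat \<Rightarrow> real" where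
  "line_dist n i j = (if i = j then 0 else 1 + \<bar>real i - real j\<bar> / real n)"

text \<open>The guard \<open>i \<noteq> j\<close> keeps the diagonal at 0 when \<open>a = b\<close>,
  so this is a metric for all \<open>a\<close> and \<open>b\<close>.\<close>

definition shortcut_dist :: "nat \<Rightarrow> nat \<Rightarrow> nat \<Rightarrow> nat \<Rightarrow> nat \<Rightarrow> real" where
  "shortcut_dist n a b i j = (if i \<noteq> j \<and> {i, j} = {a, b} then 1 else line_dist n i j)"

text \<open>A detour through a third point costs at least 1 + 1, the largest possible distance.
  Symmetry and nonnegativity are required off \<open>S\<close> too, because
  \<open>Metric_space\<close> demands them globally.\<close>

lemma Metric_space_one_two:
  fixes d :: "'a \<Rightarrow> 'a \<Rightarrow> real"
  assumes "\<And>x. x \<in> S \<Longrightarrow> d x x = 0"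
    and "\<And>x y. d x y = d y x"
    and "\<And>x y. 0 \<le> d x y"
    and "\<And>x y. x \<in> S \<Longrightarrow> y \<in> S \<Longrightarrow> x \<noteq> y \<Longrightarrow> 1 \<le> d x y \<and> d x y \<le> 2"
  shows "Metric_space S d"
proof
  show "0 \<le> d x y" for x y using assms(3) .
  show "d x y = d y x" for x y using assms(2) .
  show "d x y = 0 \<longleftrightarrow> x = y" if "x \<in> S" "y \<in> S" for x y
    using assms(1)[of x] assms(4)[of x y] that by fastforce
  show "d x z \<le> d x y + d y z" if "x \<in> S" "y \<in> S" "z \<in> S" for x y z
  proof (cases "x = y \<or> y = z \<or> x = z")
    case True
    then show ?thesis
      using assms(1)[of x] assms(1)[of y] assms(3)[of x y] assms(3)[of y z] that by auto
  next
    case False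
    then show ?thesis
      using assms(4)[of x y] assms(4)[of y z] assms(4)[of x z] that by auto
  qed
qed

lemma line_dist_bounds:
  assumes "i < n" "j < n" "i \<noteq> j"
  shows "1 < line_dist n i j \<and> line_dist n i j \<le> 2"
proof -
  have "\<bar>real i - real j\<bar> \<le> real n" "\<bar>real i - real j\<bar> > 0" using assms by auto
  then show ?thesis using assms by (auto simp: line_dist_def divide_simps)
qed

lemma Metric_space_line_dist: "Metric_space {..<n} (line_dist n)"
proof (rule Metric_space_one_two)
  show "1 \<le> line_dist n x y \<and> line_dist n x y \<le> 2"
    if "x \<in> {..<n}" "y \<in> {..<n}" "x \<noteq> y" for x y
    using line_dist_bounds[of x n y] that by auto
qed (auto simp: line_dist_def abs_minus_commute)

lemma Metric_space_shortcut_dist: "Metric_space {..<n} (shortcut_dist n a b)"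
proof (rule Metric_space_one_two)
  show "1 \<le> shortcut_dist n a b x y \<and> shortcut_dist n a b x y \<le> 2"
    if "x \<in> {..<n}" "y \<in> {..<n}" "x \<noteq> y" for x y
    using line_dist_bounds[of x n y] that by (auto simp: shortcut_dist_def)
qed (auto simp: shortcut_dist_def line_dist_def abs_minus_commute insert_commute)

section \<open>Navigable graphs for the shortcut metric\<close>

lemma navigable_shortcut_dist_forces_edge:
  assumes "navigable {..<n} (shortcut_dist n a b) E" "a < n" "b < n" "a \<noteq> b"
  shows "(a, b) \<in> E"
proof -
  have "shortcut_dist n a b a b = 1"
    using assms by (simp add: shortcut_dist_def)
  then obtain u where u: "(a, u) \<in> E" "shortcut_dist n a b u b < 1"
    using assms unfolding navigable_def by (metis lessThan_iff zero_less_one)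
  moreover have "u < n"
    using u(1) assms(1) by (auto simp: navigable_def)
  ultimately have "u = b"
    using line_dist_bounds[of u n b] assms
    by (cases "u = b") (auto simp: shortcut_dist_def split: if_splits)
  with u(1) show ?thesis by simp
qed

text \<open>The extra edge has both orientations: from either endpoint, a path step towards the
  other one ends at distance above 1 from it, unless it arrives there.\<close>

definition shortcut_path :: "nat \<Rightarrow> nat \<Rightarrow> nat \<Rightarrow> (nat \<times> nat) set" where
  "shortcut_path n a b =
     {(s, u). s < n \<and> u < n \<and> (u = Suc s \<or> s = Suc u)} \<union> {(a, b), (b, a)}"

lemma line_dist_step:
  assumes "s < n" "t < n" "s \<noteq> t"
  shows "line_dist n (if s < t then Suc s else s - 1) t < line_dist n s t"
  using assms by (auto simp: line_dist_def divide_simps of_nat_diff add_pos_nonneg)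

lemma shortcut_dist_le_line_dist:
  "shortcut_dist n a b i j \<le> line_dist n i j"
  by (auto simp: shortcut_dist_def line_dist_def)

lemma navigable_shortcut_path:
  assumes "a < n" "b < n"
  shows "navigable {..<n} (shortcut_dist n a b) (shortcut_path n a b)"
  unfolding navigable_def
proof (intro conjI ballI impI)
  show "shortcut_path n a b \<subseteq> {..<n} \<times> {..<n}"
    using assms by (auto simp: shortcut_path_def)
  fix s t assume st: "s \<in> {..<n}" "t \<in> {..<n}" and pos: "shortcut_dist n a b s t > 0"
  then have "s \<noteq> t"
    by (auto simp: shortcut_dist_def line_dist_def)
  show "\<exists>u. (s, u) \<in> shortcut_path n a b \<and> shortcut_dist n a b u t < shortcut_dist n a b s t"
  proof (cases "{s, t} = {a, b}")
    case True
    then have "(s, t) \<in> shortcut_path n a b"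
      by (auto simp: shortcut_path_def doubleton_eq_iff)
    moreover have "shortcut_dist n a b t t = 0"
      by (simp add: shortcut_dist_def line_dist_def)
    ultimately show ?thesis using pos by metis
  next
    case False
    let ?u = "if s < t then Suc s else s - 1"
    have "(s, ?u) \<in> shortcut_path n a b"
      using st \<open>s \<noteq> t\<close> by (auto simp: shortcut_path_def)
    \<comment> \<open>Only the distance from \<open>s\<close> has to agree with
      \<open>line_dist\<close>. At \<open>?u\<close> the inequality suffices, so
      \<open>{?u, t} = {a, b}\<close> does no harm.\<close>
    moreover have "shortcut_dist n a b ?u t < shortcut_dist n a b s t"
      using le_less_trans[OF shortcut_dist_le_line_dist line_dist_step[of s n t]] st \<open>s \<noteq> t\<close> False
      by (simp add: shortcut_dist_def)
    ultimately show ?thesis by blast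
  qed
qed

lemma max_out_degree_shortcut_path:
  assumes "n > 0" "a \<noteq> b"
  shows "max_out_degree {..<n} (shortcut_path n a b) \<le> 3"
  unfolding max_out_degree_def
proof (rule Max.boundedI)
  fix m assume "m \<in> (\<lambda>s. card {u. (s, u) \<in> shortcut_path n a b}) ` {..<n}"
  then obtain s where m: "m = card {u. (s, u) \<in> shortcut_path n a b}" by auto
  \<comment> \<open>A superset is enough: the truncated \<open>s - 1\<close> at \<open>s = 0\<close>
    and the third entry for \<open>s\<close> outside \<open>{a, b}\<close> are just padding.\<close>
  have "{u. (s, u) \<in> shortcut_path n a b} \<subseteq> {Suc s, s - 1, if s = a then b else a}"
    using assms by (auto simp: shortcut_path_def)
  then have "m \<le> card {Suc s, s - 1, if s = a then b else a}"
    unfolding m by (intro card_mono) auto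
  also have "\<dots> \<le> 3" by (simp add: card_insert_if)
  finally show "m \<le> 3" .
qed (use assms in auto)

text \<open>Grouping edges by source turns a degree bound into an edge bound, so that both
  objectives can be handled through the number of edges.\<close>

lemma card_le_max_out_degree:
  assumes "finite P" "E \<subseteq> P \<times> P"
  shows "card E \<le> card P * max_out_degree P E"
proof -
  have fin: "finite {u. (s, u) \<in> E}" for s
    by (rule finite_subset[OF _ assms(1)]) (use assms(2) in auto)
  have "E = (SIGMA s:P. {u. (s, u) \<in> E})" using assms(2) by auto
  then have "card E = (\<Sum>s\<in>P. card {u. (s, u) \<in> E})"
    using card_SigmaI[of P "\<lambda>s. {u. (s, u) \<in> E}"] assms(1) fin by simp
  also have "\<dots> \<le> card P * max_out_degree P E"
    using sum_bounded_above[of P "\<lambda>s. card {u. (s, u) \<in> E}" "max_out_degree P E"] assms(1)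
    by (simp add: max_out_degree_def)
  finally show ?thesis .
qed

lemma card_approx_sparsest_navigable_le:
  assumes obj: "obj = max_out_degree \<or> obj = num_edges"
    and approx: "approx_sparsest_navigable obj c {..<n} (shortcut_dist n a b) E"
    and ab: "a < n" "b < n" "a \<noteq> b"
  shows "real (card E) \<le> 3 * \<bar>c\<bar> * real n"
proof -
  let ?H = "shortcut_path n a b"
  have nav: "navigable {..<n} (shortcut_dist n a b) ?H"
    using navigable_shortcut_path ab by blast
  have le: "real (obj {..<n} E) \<le> c * real (obj {..<n} ?H)"
    using approx nav by (auto simp: approx_sparsest_navigable_def)
  have deg: "max_out_degree {..<n} ?H \<le> 3"
    using max_out_degree_shortcut_path ab by simp
  have E: "E \<subseteq> {..<n} \<times> {..<n}" and H: "?H \<subseteq> {..<n} \<times> {..<n}"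
    using approx nav by (auto simp: approx_sparsest_navigable_def navigable_def)
  \<comment> \<open>The sign of \<open>c\<close> is arbitrary; passing to
    \<open>\<bar>c\<bar>\<close> makes the product monotone in the second factor.\<close>
  have abs_le: "c * real m \<le> \<bar>c\<bar> * r" if "real m \<le> r" for m r
    using that by (intro mult_mono) auto
  from obj show ?thesis
  proof
    assume "obj = max_out_degree"
    then have "real (max_out_degree {..<n} E) \<le> \<bar>c\<bar> * 3"
      using le abs_le[of "max_out_degree {..<n} ?H" 3] deg by simp
    then have "real n * real (max_out_degree {..<n} E) \<le> real n * (\<bar>c\<bar> * 3)"
      by (intro mult_left_mono) auto
    moreover have "real (card E) \<le> real n * real (max_out_degree {..<n} E)"
      using card_le_max_out_degree[OF _ E] by (simp flip: of_nat_mult)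
    ultimately show ?thesis by (simp add: mult_ac)
  next
    assume "obj = num_edges"
    moreover have "card ?H \<le> n * 3"
      using le_trans[OF card_le_max_out_degree[OF _ H] mult_le_mono2[OF deg]] by simp
    then have "real (card ?H) \<le> real n * 3" by linarith
    ultimately show ?thesis
      using le abs_le[of "card ?H" "real n * 3"] by (simp add: num_edges_def mult_ac)
  qed
qed

section \<open>Indistinguishable runs\<close>

primrec queried :: "(nat \<Rightarrow> nat \<Rightarrow> real) \<Rightarrow> query_alg \<Rightarrow> (nat \<times> nat) set" where
  "queried d (Output E) = {}"
| "queried d (Query i j k) = insert (min i j, max i j) (queried d (k (d i j)))"

lemma finite_queried: "finite (queried d T)"
  by (induction T) auto

lemma card_queried_le: "card (queried d T) \<le> num_queries d T"
proof (induction T)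
  case (Query i j k)
  then have "card (queried d (k (d i j))) \<le> num_queries d (k (d i j))" by blast
  then show ?case by (simp add: finite_queried card_insert_if)
qed simp

text \<open>By induction, all answers agree, so both runs descend into the same subtrees. Since
  \<open>queried\<close> sorts each pair and \<open>a < b\<close>, an unrecorded
  \<open>(a, b)\<close> was asked in neither order.\<close>

lemma run_shortcut_dist_eq:
  assumes "(a, b) \<notin> queried (line_dist n) T" "a < b"
  shows "run (shortcut_dist n a b) T = run (line_dist n) T"
  using assms
proof (induction T)
  case (Query i j k)
  have "shortcut_dist n a b i j = line_dist n i j"
    using Query.prems by (auto simp: shortcut_dist_def doubleton_eq_iff min_def max_def)
  with Query show ?case by auto
qed simp

section \<open>Counting successful pairs for a fixed seed\<close>

abbreviation pairs :: "nat \<Rightarrow> (nat \<times> nat) set" where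
  "pairs n \<equiv> {(a, b). a < b \<and> b < n}"

lemma finite_pairs: "finite (pairs n)"
  by (rule finite_subset[of _ "{..<n} \<times> {..<n}"]) auto

lemma card_pairs_ge:
  assumes "n \<ge> 2"
  shows "(real n)\<^sup>2 / 4 \<le> real (card (pairs n))"
proof -
  have "card (pairs n) = (\<Sum>b<n. b)"
  proof -
    have "pairs n = (\<lambda>(b, a). (a, b)) ` (SIGMA b:{..<n}. {..<b})" by auto
    moreover have "inj_on (\<lambda>(b, a). (a, b)) (SIGMA b:{..<n}. {..<b})"
      by (auto simp: inj_on_def)
    ultimately show ?thesis by (simp add: card_image)
  qed
  moreover have "(\<Sum>b<n. real b) = real n * (real n - 1) / 2"
    by (induction n) (auto simp: field_simps)
  ultimately have "real (card (pairs n)) = real n * (real n - 1) / 2" by simp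
  \<comment> \<open>This is where \<open>n \<ge> 2\<close> enters: n(n - 1)/2 is at least n*n/4
    exactly when n*n \<ge> 2n, for the values at hand.\<close>
  moreover have "real n * 2 \<le> real n * real n"
    using assms by (intro mult_left_mono) auto
  ultimately show ?thesis by (simp add: power2_eq_square field_simps)
qed

text \<open>All unqueried successful pairs share one output, \<open>?E\<close>, which must contain
  each of them as an edge. Correctness of \<open>?E\<close> for any single such pair already bounds
  its size, and hence their number.\<close>

lemma card_successes_le:
  fixes c :: real and n :: nat and T :: query_alg
  assumes obj: "obj = max_out_degree \<or> obj = num_edges"
  defines "S \<equiv> {(a, b) \<in> pairs n. approx_sparsest_navigable obj c {..<n}
                  (shortcut_dist n a b) (run (shortcut_dist n a b) T)}"
  shows "real (card S) \<le> real (num_queries (line_dist n) T) + 3 * \<bar>c\<bar> * real n"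
proof -
  let ?Q = "queried (line_dist n) T" and ?E = "run (line_dist n) T"
  have finS: "finite S"
    by (rule finite_subset[OF _ finite_pairs[of n]]) (auto simp: S_def)
  have approx: "approx_sparsest_navigable obj c {..<n} (shortcut_dist n a b) ?E"
    if "(a, b) \<in> S - ?Q" for a b
    using that run_shortcut_dist_eq[of a b n T] by (auto simp: S_def)
  have "real (card (S - ?Q)) \<le> 3 * \<bar>c\<bar> * real n"
  proof (cases "S - ?Q = {}")
    case False
    then obtain a b where ab: "(a, b) \<in> S - ?Q" by auto
    have "finite ?E"
      using approx[OF ab] finite_subset[of ?E "{..<n} \<times> {..<n}"]
      by (auto simp: approx_sparsest_navigable_def navigable_def)
    moreover have "S - ?Q \<subseteq> ?E"
    proof
      fix e assume e: "e \<in> S - ?Q"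
      obtain x y where xy: "e = (x, y)" by (cases e)
      then have "x < y" "y < n" using e by (auto simp: S_def)
      then show "e \<in> ?E"
        using navigable_shortcut_dist_forces_edge[of n x y ?E] approx[of x y] e xy
        by (auto simp: approx_sparsest_navigable_def)
    qed
    ultimately have "card (S - ?Q) \<le> card ?E" by (rule card_mono)
    moreover have "a < b" "b < n" using ab by (auto simp: S_def)
    then have "real (card ?E) \<le> 3 * \<bar>c\<bar> * real n"
      using card_approx_sparsest_navigable_le[OF obj approx[OF ab]] by simp
    ultimately show ?thesis by linarith
  qed (metis abs_ge_zero card.empty mult_nonneg_nonneg of_nat_0 of_nat_0_le_iff zero_le_numeral)
  moreover have "card S \<le> card ?Q + card (S - ?Q)"
  proof -
    have "card S \<le> card (?Q \<union> (S - ?Q))"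
      by (rule card_mono) (auto simp: finite_queried finS)
    also have "\<dots> \<le> card ?Q + card (S - ?Q)" by (rule card_Un_le)
    finally show ?thesis .
  qed
  ultimately show ?thesis
    using card_queried_le[of "line_dist n" T] by linarith
qed

section \<open>Averaging over the random seed\<close>

lemma expected_num_queries_line_dist_ge:
  fixes M :: "'r measure"
  assumes alg: "randomized_query_alg n M A"
    and obj: "obj = max_out_degree \<or> obj = num_edges"
    and succ: "\<And>d. Metric_space {..<n} d \<Longrightarrow>
      measure M {\<omega> \<in> space M. approx_sparsest_navigable obj c {..<n} d (run d (A \<omega>))} \<ge> p"
    and "p \<ge> 0"
  shows "ennreal (p * real (card (pairs n))) \<le>
     (\<integral>\<^sup>+ \<omega>. of_nat (num_queries (line_dist n) (A \<omega>)) \<partial>M) + ennreal (3 * \<bar>c\<bar> * real n)"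
proof -
  interpret prob_space M using alg by (simp add: randomized_query_alg_def)
  define S where "S = (\<lambda>(a, b). {\<omega> \<in> space M. approx_sparsest_navigable obj c {..<n}
    (shortcut_dist n a b) (run (shortcut_dist n a b) (A \<omega>))})"
  have meas: "S e \<in> sets M" for e
  proof (cases e)
    case (Pair a b)
    let ?d = "shortcut_dist n a b"
    let ?P = "Pow ({..<n} \<times> {..<n})"
    have run: "(\<lambda>\<omega>. run ?d (A \<omega>)) \<in> measurable M (count_space ?P)"
      using alg Metric_space_shortcut_dist by (auto simp: randomized_query_alg_def)
    \<comment> \<open>Success depends on the seed only through the output graph, and every set of
      graphs is measurable in the count space.\<close>
    have "S e = (\<lambda>\<omega>. run ?d (A \<omega>)) -`
        {E \<in> ?P. approx_sparsest_navigable obj c {..<n} ?d E} \<inter> space M"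
      using Pair measurable_space[OF run] by (auto simp: S_def)
    also have "\<dots> \<in> sets M"
      by (rule measurable_sets[OF run]) auto
    finally show ?thesis .
  qed
  have num: "(\<lambda>\<omega>. of_nat (num_queries (line_dist n) (A \<omega>)) :: ennreal) \<in> borel_measurable M"
  proof -
    have "(\<lambda>\<omega>. num_queries (line_dist n) (A \<omega>)) \<in> measurable M (count_space UNIV)"
      using alg Metric_space_line_dist by (auto simp: randomized_query_alg_def)
    then show ?thesis by measurable
  qed
  have prob: "ennreal p \<le> emeasure M (S e)" for e
    using succ[OF Metric_space_shortcut_dist[of n "fst e" "snd e"]]
    by (auto simp: emeasure_eq_measure S_def case_prod_beta intro!: ennreal_leI)
  have pointwise: "(\<Sum>e\<in>pairs n. indicator (S e) \<omega> :: ennreal) \<le>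
      of_nat (num_queries (line_dist n) (A \<omega>)) + ennreal (3 * \<bar>c\<bar> * real n)"
    if "\<omega> \<in> space M" for \<omega>
  proof -
    let ?S = "{(a, b) \<in> pairs n. approx_sparsest_navigable obj c {..<n}
                  (shortcut_dist n a b) (run (shortcut_dist n a b) (A \<omega>))}"
    \<comment> \<open>For fixed \<open>\<omega>\<close> the indicators count the pairs whose
      shortcut metric is solved with this seed.\<close>
    have "(\<Sum>e\<in>pairs n. indicator (S e) \<omega> :: ennreal) = (\<Sum>e\<in>pairs n. indicator ?S e)"
      using that by (intro sum.cong) (auto simp: indicator_def S_def)
    also have "\<dots> = of_nat (card (pairs n \<inter> ?S))"
      using finite_pairs by (simp add: indicator_def sum.If_cases)
    also have "pairs n \<inter> ?S = ?S" by auto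
    also have "(of_nat (card ?S) :: ennreal) = ennreal (real (card ?S))"
      by (simp add: ennreal_of_nat_eq_real_of_nat)
    also have "\<dots> \<le> ennreal (real (num_queries (line_dist n) (A \<omega>)) + 3 * \<bar>c\<bar> * real n)"
      by (rule ennreal_leI) (rule card_successes_le[OF obj])
    also have "\<dots> = of_nat (num_queries (line_dist n) (A \<omega>)) + ennreal (3 * \<bar>c\<bar> * real n)"
      by (simp add: ennreal_of_nat_eq_real_of_nat ennreal_plus)
    finally show ?thesis .
  qed
  have "ennreal (p * real (card (pairs n))) = (\<Sum>e\<in>pairs n. ennreal p)"
    using \<open>p \<ge> 0\<close> by (simp add: ennreal_mult ennreal_of_nat_eq_real_of_nat mult.commute)
  also have "\<dots> \<le> (\<Sum>e\<in>pairs n. emeasure M (S e))"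
    by (intro sum_mono prob)
  also have "\<dots> = (\<integral>\<^sup>+ \<omega>. (\<Sum>e\<in>pairs n. indicator (S e) \<omega>) \<partial>M)"
    using meas by (simp add: nn_integral_sum)
  also have "\<dots> \<le> (\<integral>\<^sup>+ \<omega>. of_nat (num_queries (line_dist n) (A \<omega>)) +
      ennreal (3 * \<bar>c\<bar> * real n) \<partial>M)"
    by (intro nn_integral_mono pointwise)
  also have "\<dots> = (\<integral>\<^sup>+ \<omega>. of_nat (num_queries (line_dist n) (A \<omega>)) \<partial>M) +
      ennreal (3 * \<bar>c\<bar> * real n)"
    using num by (simp add: nn_integral_add emeasure_space_1)
  finally show ?thesis .
qed

theorem theorem6p1:
  fixes M :: "nat \<Rightarrow> 'r measure"
    and A :: "nat \<Rightarrow> 'r \<Rightarrow> query_alg"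
    and obj :: "nat set \<Rightarrow> (nat \<times> nat) set \<Rightarrow> nat"
    and c :: "nat \<Rightarrow> real"
    and p :: real
  assumes "\<And>n. randomized_query_alg n (M n) (A n)"
    and "obj = max_out_degree \<or> obj = num_edges"
    and "c \<in> o(\<lambda>n. real n)"
    and "p > 0"
    and "\<forall>\<^sub>F n in sequentially. \<forall>d. Metric_space {..<n} d \<longrightarrow>
           measure (M n) {\<omega> \<in> space (M n).
             approx_sparsest_navigable obj (c n) {..<n} d (run d (A n \<omega>))} \<ge> p"
  shows "\<exists>K>0. \<forall>\<^sub>F n in sequentially. \<exists>d. Metric_space {..<n} d \<and>
           (\<integral>\<^sup>+ \<omega>. of_nat (num_queries d (A n \<omega>)) \<partial>M n) \<ge> ennreal (K * (real n)\<^sup>2)"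
proof (intro exI conjI)
  \<comment> \<open>The pairs contribute at least p/4 times the square of n; half of this pays for
    the output edges and p/8 remains.\<close>
  show "p / 8 > 0" using assms(4) by simp
  \<comment> \<open>The factor 3 in the edge bound turns p/24 into p/8.\<close>
  have "\<forall>\<^sub>F n in sequentially. norm (c n) \<le> p / 24 * norm (real n)"
    using landau_o.smallD[OF assms(3), of "p / 24"] assms(4) by simp
  with assms(5) eventually_ge_at_top[of 2]
  show "\<forall>\<^sub>F n in sequentially. \<exists>d. Metric_space {..<n} d \<and>
      (\<integral>\<^sup>+ \<omega>. of_nat (num_queries d (A n \<omega>)) \<partial>M n) \<ge> ennreal (p / 8 * (real n)\<^sup>2)"
  proof eventually_elim
    case (elim n)
    let ?I = "\<integral>\<^sup>+ \<omega>. of_nat (num_queries (line_dist n) (A n \<omega>)) \<partial>M n"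
    have "3 * \<bar>c n\<bar> * real n \<le> 3 * (p / 24 * real n) * real n"
      using elim by (intro mult_right_mono mult_left_mono) auto
    then have err: "3 * \<bar>c n\<bar> * real n \<le> p / 8 * (real n)\<^sup>2"
      by (simp add: power2_eq_square)
    have "p * ((real n)\<^sup>2 / 4) \<le> p * real (card (pairs n))"
      using card_pairs_ge[of n] elim assms(4) by (intro mult_left_mono) auto
    then have "ennreal (p / 8 * (real n)\<^sup>2 + p / 8 * (real n)\<^sup>2) \<le> ennreal (p * real (card (pairs n)))"
      by (intro ennreal_leI) simp
    also have "\<dots> \<le> ?I + ennreal (3 * \<bar>c n\<bar> * real n)"
      using expected_num_queries_line_dist_ge[OF assms(1)[of n] assms(2)] elim assms(4) by auto
    also have "\<dots> \<le> ?I + ennreal (p / 8 * (real n)\<^sup>2)"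
      using err by (intro add_left_mono ennreal_leI)
    also have "ennreal (p / 8 * (real n)\<^sup>2 + p / 8 * (real n)\<^sup>2) =
        ennreal (p / 8 * (real n)\<^sup>2) + ennreal (p / 8 * (real n)\<^sup>2)"
      using assms(4) by (intro ennreal_plus) auto
    finally have "ennreal (p / 8 * (real n)\<^sup>2) + ennreal (p / 8 * (real n)\<^sup>2) \<le>
        ?I + ennreal (p / 8 * (real n)\<^sup>2)" .
    \<comment> \<open>The cancelled summand is finite, so this is sound in \<open>ennreal\<close>
      even if \<open>?I\<close> is infinite.\<close>
    then have "ennreal (p / 8 * (real n)\<^sup>2) \<le> ?I"
      by (simp add: ennreal_add_left_cancel_le add.commute)
    then show ?case using Metric_space_line_dist by blast
  qed
qed

end
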